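(* Let $n\ge2$, let $Q\subset\mathbb{R}^n$ be a convex compact set contained in a Euclidean ball $\mathcal B_{\mathcal R}$ of radius $\mathcal R$ and containing some Euclidean ball of radius $\rho>0$. Let $g:Q\to\mathbb{R}$ be a continuous convex function and let $B>0$ satisfy $|g(x)-g(x')|\le B$ for all $x,x'\in Q$. Let $\delta\ge0$. Then, after $N\ge 2n^2\ln\left(\frac{\mathcal R}{\rho}\right)$ iterations, the ellipsoid method with $\delta$-subgradients (described in the context) applied to $\min_{x\in Q}g(x)$ returns a point $x^N\in Q$ such that $$g(x^N)-\min_{x\in Q}g(x)\le\frac{B\mathcal R}{\rho}\exp\left(-\frac{N}{2n^2}\right)+\delta .$$
   Context: A vector $\nu\in\mathbb{R}^n$ is a $\delta$-subgradient of a convex function $g:Q\to\mathbb{R}$ at $\hat x\in Q$ if $g(x)\ge g(\hat x)+\langle\nu,x-\hat x\rangle-\delta$ for all $x\in Q$; the set of these is $\partial_\delta g(\hat x)$. Ellipsoid method with $\delta$-subgradients. Input: number of iterations $N>0$, $\delta\ge0$, the ball $\mathcal B_{\mathcal R}\supseteq Q$ with center $c$ and radius $\mathcal R$. Set $\mathcal E_0=\mathcal B_{\mathcal R}$, $H_0=\mathcal R^2I_n$, $c_0=c$. For $k=0,\dots,N-1$: 1. If $c_k\in Q$, take any $w_k\in\partial_\delta g(c_k)$ (assumed to be available); if $w_k=0$, stop and return $c_k$ (this is then the output $x^N$). If $c_k\notin Q$, take any $w_k\ne0$ such that $Q\subset\{x:\langle w_k,x-c_k\rangle\le0\}$ (where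 the half-space is required to contain $Q$ within $\mathcal E_k$: $Q\cap\mathcal E_k\subset\{x\in\mathcal E_k:\langle w_k,x-c_k\rangle\le0\}$). 2. Set $$c_{k+1}=c_k-\frac1{n+1}\frac{H_kw_k}{\sqrt{w_k^\top H_kw_k}},\qquad H_{k+1}=\frac{n^2}{n^2-1}\left(H_k-\frac2{n+1}\frac{H_kw_kw_k^\top H_k}{w_k^\top H_kw_k}\right),$$ $$\mathcal E_{k+1}=\{x:(x-c_{k+1})^\top H_{k+1}^{-1}(x-c_{k+1})\le1\}.$$ Output (if not stopped earlier): $x^N\in\arg\min\{g(x):x\in\{c_0,\dots,c_N\}\cap Q\}$. *)

theory Defs
  imports "HOL-Analysis.Analysis"
begin

text \<open>The space is \<open>real ^ 'n\<close>, of dimension \<open>CARD('n)\<close>. The objective \<open>g : Q \<rightarrow> \<real>\<close>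
  is a total function of which only the values on \<open>Q\<close> are ever used.\<close>

definition delta_subdifferential ::
  "(real ^ 'n) set \<Rightarrow> (real ^ 'n \<Rightarrow> real) \<Rightarrow> real \<Rightarrow> real ^ 'n \<Rightarrow> (real ^ 'n) set" where
  "delta_subdifferential Q g \<delta> x0 = {\<nu>. \<forall>x\<in>Q. g x \<ge> g x0 + \<nu> \<bullet> (x - x0) - \<delta>}"

definition outer_prod :: "real ^ 'n \<Rightarrow> real ^ 'm \<Rightarrow> real ^ 'm ^ 'n" where
  "outer_prod v w = (\<chi> i j. v $ i * w $ j)"

definition ellipsoid_step ::
  "real ^ 'n \<Rightarrow> (real ^ 'n) \<times> (real ^ 'n ^ 'n) \<Rightarrow> (real ^ 'n) \<times> (real ^ 'n ^ 'n)" where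
  "ellipsoid_step w s =
    (let n = real CARD('n); c = fst s; H = snd s; q = w \<bullet> (H *v w) in
      (c - (1 / (n + 1)) *\<^sub>R ((1 / sqrt q) *\<^sub>R (H *v w)),
       (n\<^sup>2 / (n\<^sup>2 - 1)) *\<^sub>R
         (H - (2 / (n + 1)) *\<^sub>R ((1 / q) *\<^sub>R (H ** outer_prod w w ** H)))))"

text \<open>The method chooses the vectors \<open>w k\<close> nondeterministically; a sequence \<open>w\<close> of choices
  determines all iterates \<open>(c\<^sub>k, H\<^sub>k)\<close>. After a stop the sequence still has values, but they are
  not used.\<close>

primrec ellipsoid_state ::
  "real ^ 'n \<Rightarrow> real \<Rightarrow> (nat \<Rightarrow> real ^ 'n) \<Rightarrow> nat \<Rightarrow> (real ^ 'n) \<times> (real ^ 'n ^ 'n)" where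
  "ellipsoid_state c R w 0 = (c, R\<^sup>2 *\<^sub>R mat 1)"
| "ellipsoid_state c R w (Suc k) = ellipsoid_step (w k) (ellipsoid_state c R w k)"

definition ell_center :: "real ^ 'n \<Rightarrow> real \<Rightarrow> (nat \<Rightarrow> real ^ 'n) \<Rightarrow> nat \<Rightarrow> real ^ 'n" where
  "ell_center c R w k = fst (ellipsoid_state c R w k)"

definition ell_matrix :: "real ^ 'n \<Rightarrow> real \<Rightarrow> (nat \<Rightarrow> real ^ 'n) \<Rightarrow> nat \<Rightarrow> real ^ 'n ^ 'n" where
  "ell_matrix c R w k = snd (ellipsoid_state c R w k)"

fun ell_set :: "real ^ 'n \<Rightarrow> real \<Rightarrow> (nat \<Rightarrow> real ^ 'n) \<Rightarrow> nat \<Rightarrow> (real ^ 'n) set" where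
  "ell_set c R w 0 = cball c R"
| "ell_set c R w (Suc k) =
    {x. (x - ell_center c R w (Suc k)) \<bullet>
        (matrix_inv (ell_matrix c R w (Suc k)) *v (x - ell_center c R w (Suc k))) \<le> 1}"

text \<open>For \<open>c\<^sub>k \<notin> Q\<close> the half-space only has to contain \<open>Q \<inter> E\<^sub>k\<close>, not all of \<open>Q\<close>.\<close>

definition admissible_choice ::
  "(real ^ 'n) set \<Rightarrow> (real ^ 'n \<Rightarrow> real) \<Rightarrow> real \<Rightarrow> real ^ 'n \<Rightarrow> real \<Rightarrow>
    (nat \<Rightarrow> real ^ 'n) \<Rightarrow> nat \<Rightarrow> bool" where
  "admissible_choice Q g \<delta> c R w k \<longleftrightarrow>
    (if ell_center c R w k \<in> Q
     then w k \<in> delta_subdifferential Q g \<delta> (ell_center c R w k)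
     else w k \<noteq> 0 \<and>
       Q \<inter> ell_set c R w k \<subseteq> {x \<in> ell_set c R w k. w k \<bullet> (x - ell_center c R w k) \<le> 0})"

definition stops_at ::
  "(real ^ 'n) set \<Rightarrow> real ^ 'n \<Rightarrow> real \<Rightarrow> (nat \<Rightarrow> real ^ 'n) \<Rightarrow> nat \<Rightarrow> bool" where
  "stops_at Q c R w k \<longleftrightarrow> ell_center c R w k \<in> Q \<and> w k = 0"

definition ellipsoid_execution ::
  "(real ^ 'n) set \<Rightarrow> (real ^ 'n \<Rightarrow> real) \<Rightarrow> real \<Rightarrow> real ^ 'n \<Rightarrow> real \<Rightarrow> nat \<Rightarrow>
    (nat \<Rightarrow> real ^ 'n) \<Rightarrow> bool" where
  "ellipsoid_execution Q g \<delta> c R N w \<longleftrightarrow>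
    (\<forall>k<N. (\<forall>j<k. \<not> stops_at Q c R w j) \<longrightarrow> admissible_choice Q g \<delta> c R w k)"

text \<open>The possible results of an execution: a set, because the final argmin need not be unique.
  It is empty if the method does not stop early and no \<open>c\<^sub>k\<close> lies in \<open>Q\<close>.\<close>

definition ellipsoid_outputs ::
  "(real ^ 'n) set \<Rightarrow> (real ^ 'n \<Rightarrow> real) \<Rightarrow> real ^ 'n \<Rightarrow> real \<Rightarrow> nat \<Rightarrow>
    (nat \<Rightarrow> real ^ 'n) \<Rightarrow> (real ^ 'n) set" where
  "ellipsoid_outputs Q g c R N w =
    (if \<exists>k<N. stops_at Q c R w k
     then {ell_center c R w (LEAST k. stops_at Q c R w k)}
     else {x. is_arg_min g (\<lambda>y. y \<in> ell_center c R w ` {0..N} \<inter> Q) x})"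

end

theory Submission
  imports Defs
begin

text \<open>Every ellipsoid is kept in the form \<open>E\<^sub>k = c\<^sub>k + A\<^sub>k(cball 0 1)\<close> with
  \<open>H\<^sub>k = A\<^sub>k A\<^sub>k\<^sup>T\<close>. A step multiplies \<open>A\<^sub>k\<close> by an orthogonal and a diagonal matrix, so \<open>\<bar>det A\<^sub>k\<bar>\<close>
  shrinks by a constant factor smaller than \<open>exp (- 1 / (2 n))\<close>.

  Let \<open>x\<^sub>0\<close> minimize \<open>g\<close> and let \<open>\<theta> = R / \<rho> * exp (- N / (2 n\<^sup>2)) \<le> 1\<close>. The shrunken copy
  \<open>(1 - \<theta>) x\<^sub>0 + \<theta> Q\<close> contains a ball of radius \<open>\<theta> \<rho>\<close>, too large to fit into \<open>E\<^sub>N\<close>. Hence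
  some step \<open>k < N\<close> cuts off a point \<open>x\<close> of this copy. Points of \<open>Q\<close> are only cut off at a centre
  \<open>c\<^sub>k \<in> Q\<close>, and then \<open>g c\<^sub>k \<le> g x + \<delta>\<close> by the subgradient inequality, while
  \<open>g x \<le> g x\<^sub>0 + \<theta> B\<close> by convexity.

  That the ball does not fit is shown without Lebesgue measure, since the library's formula for
  the measure of a linear image requires a well-ordered index type: if \<open>A(cball 0 1)\<close> contains a
  ball of radius \<open>r\<close>, then \<open>r A\<^sup>-\<^sup>1\<close> is a contraction, hence \<open>r\<^sup>n \<le> \<bar>det A\<bar>\<close>.\<close>

section \<open>Algebra of matrices and outer products\<close>

lemma matrix_outer_prod:
  fixes M :: "real ^ 'm ^ 'k"
  shows "M ** outer_prod v w = outer_prod (M *v v) w"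
  by (simp add: outer_prod_def matrix_matrix_mult_def matrix_vector_mult_def vec_eq_iff
      sum_distrib_right mult.assoc)

lemma outer_prod_matrix:
  fixes M :: "real ^ 'k ^ 'm"
  shows "outer_prod v w ** M = outer_prod v (w v* M)"
  by (simp add: outer_prod_def matrix_matrix_mult_def vector_matrix_mult_def vec_eq_iff
      sum_distrib_left mult_ac)

lemma outer_prod_scaleR:
  "outer_prod (r *\<^sub>R v) (s *\<^sub>R w) = (r * s) *\<^sub>R outer_prod v w"
  by (simp add: outer_prod_def vec_eq_iff)

lemma matrix_diff_ldistrib:
  fixes A :: "real ^ 'm ^ 'k" and B C :: "real ^ 'l ^ 'm"
  shows "A ** (B - C) = A ** B - A ** C"
  by (simp add: matrix_matrix_mult_def vec_eq_iff sum_subtractf right_diff_distrib)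

lemma matrix_diff_rdistrib:
  fixes A :: "real ^ 'l ^ 'm" and B C :: "real ^ 'm ^ 'k"
  shows "(B - C) ** A = B ** A - C ** A"
  by (simp add: matrix_matrix_mult_def vec_eq_iff sum_subtractf left_diff_distrib)

lemma matrix_inv_right:
  fixes A :: "'a::semiring_1 ^ 'n ^ 'n"
  assumes "invertible A"
  shows "A ** matrix_inv A = mat 1"
  using assms someI_ex[of "\<lambda>A'. A ** A' = mat 1 \<and> A' ** A = mat 1"]
  unfolding invertible_def matrix_inv_def by blast

section \<open>Ellipsoids as affine images of the unit ball\<close>

text \<open>Under the substitution x = c + A y the quadratic form becomes |y|^2: if z is the inverse
  of A A^T applied to A y, then cancelling A in A (A^T z) = A y leaves A^T z = y, so the form equals
  z . A y = y . y.\<close>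

lemma ellipsoid_eq_linear_image:
  fixes A :: "real ^ 'n ^ 'n"
  assumes "invertible A"
  shows "{x. (x - c) \<bullet> (matrix_inv (A ** transpose A) *v (x - c)) \<le> 1}
       = (\<lambda>y. c + A *v y) ` cball 0 1"
proof -
  define H where "H = A ** transpose A"
  have iH: "invertible H"
    unfolding H_def by (intro invertible_mult transpose_invertible assms)
  have inj: "inj ((*v) A)"
    using assms by (simp add: inj_matrix_vector_mult)
  have form: "(A *v y) \<bullet> (matrix_inv H *v (A *v y)) = (norm y)\<^sup>2" for y
  proof -
    define z where "z = matrix_inv H *v (A *v y)"
    have "H *v z = A *v y"
      unfolding z_def by (metis matrix_inv_right[OF iH] matrix_vector_mul_assoc matrix_vector_mul_lid)
    then have "A *v (transpose A *v z) = A *v y"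
      unfolding H_def by (simp only: matrix_vector_mul_assoc)
    then have "z v* A = y"
      using inj by (simp add: inj_def)
    then have "z \<bullet> (A *v y) = y \<bullet> y"
      by (simp add: dot_lmul_matrix[symmetric])
    then show ?thesis
      by (simp add: z_def inner_commute power2_norm_eq_inner)
  qed
  have surj: "\<exists>y. x = c + A *v y" for x
    by (rule exI[of _ "matrix_inv A *v (x - c)"])
       (simp add: matrix_vector_mul_assoc matrix_inv_right[OF assms])
  have eq: "(c + A *v y - c) \<bullet> (matrix_inv H *v (c + A *v y - c)) \<le> 1 \<longleftrightarrow> y \<in> cball 0 1" for y
    by (simp add: form power_le_one_iff abs_square_le_1[of "norm y"] del: power2_norm_eq_inner)
  show ?thesis
    unfolding H_def[symmetric]
  proof (intro set_eqI)
    fix x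
    obtain y where x: "x = c + A *v y" using surj by blast
    have "inj (\<lambda>y. c + A *v y)" using inj by (simp add: inj_def)
    from inj_image_mem_iff[OF this, of y "cball 0 1"] eq[of y]
    show "x \<in> {x. (x - c) \<bullet> (matrix_inv H *v (x - c)) \<le> 1}
        \<longleftrightarrow> x \<in> (\<lambda>y. c + A *v y) ` cball 0 1"
      unfolding x mem_Collect_eq by simp
  qed
qed

section \<open>Shrinking of the volume in one step\<close>

text \<open>The difference of the two sides vanishes at 0 and has derivative ln(1+t) - ln(1-t) - 2t.
  This again vanishes at 0 and has the positive derivative 2 t^2 / (1 - t^2), so monotonicity
  applies twice.\<close>

lemma sq_less_entropy_sum:
  fixes t :: real
  assumes "0 < t" "t < 1"
  shows "t\<^sup>2 < (1 + t) * ln (1 + t) + (1 - t) * ln (1 - t)"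
proof -
  have d: "0 < ln (1 + x) - ln (1 - x) - 2 * x" if "0 < x" "x < 1" for x :: real
  proof -
    let ?f = "\<lambda>x::real. ln (1 + x) - ln (1 - x) - 2 * x"
    have "?f 0 < ?f x"
    proof (rule DERIV_pos_imp_increasing_open[OF \<open>0 < x\<close>])
      fix y assume y: "0 < y" "y < x"
      have "(?f has_real_derivative (1 / (1 + y) + 1 / (1 - y) - 2)) (at y)"
        using y that by (auto intro!: derivative_eq_intros)
      moreover have "1 / (1 + y) + 1 / (1 - y) - 2 = 2 * y\<^sup>2 / ((1 + y) * (1 - y))"
      proof -
        have "0 < (1 + y) * (1 - y)" using y that by (intro mult_pos_pos) auto
        then have "1 - y\<^sup>2 \<noteq> 0" and p: "(1 + y) * (1 - y) = 1 - y\<^sup>2"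
          by (simp_all add: algebra_simps power2_eq_square)
        have "1 / (1 + y) + 1 / (1 - y) = 2 / (1 - y\<^sup>2)"
          unfolding p[symmetric] using y that by (simp add: divide_simps)
        moreover have "2 / r - 2 = 2 * (1 - r) / r" if "r \<noteq> 0" for r :: real
          using that by (simp add: field_simps)
        ultimately show ?thesis
          using \<open>1 - y\<^sup>2 \<noteq> 0\<close> unfolding p by (metis diff_diff_eq2 add_diff_cancel_left')
      qed
      moreover have "2 * y\<^sup>2 / ((1 + y) * (1 - y)) > 0"
        using y that by (intro divide_pos_pos mult_pos_pos) auto
      ultimately show "\<exists>D. (?f has_real_derivative D) (at y) \<and> D > 0" by metis
    qed (use that in \<open>auto intro!: continuous_intros\<close>)
    then show ?thesis by simp
  qed
  let ?h = "\<lambda>x::real. (1 + x) * ln (1 + x) + (1 - x) * ln (1 - x) - x\<^sup>2"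
  have "?h 0 < ?h t"
  proof (rule DERIV_pos_imp_increasing_open[OF \<open>0 < t\<close>])
    fix y assume y: "0 < y" "y < t"
    have "(?h has_real_derivative (ln (1 + y) - ln (1 - y) - 2 * y)) (at y)"
      using y assms by (auto intro!: derivative_eq_intros)
    with d[of y] y assms show "\<exists>D. (?h has_real_derivative D) (at y) \<and> D > 0" by auto
  qed (use assms in \<open>auto intro!: continuous_intros\<close>)
  then show ?thesis by simp
qed

text \<open>The product of the semi-axes of the ellipsoid that replaces the unit half-ball.\<close>

definition ellipsoid_volume_ratio :: "nat \<Rightarrow> real" where
  "ellipsoid_volume_ratio n = n / (n + 1) * (n / sqrt (n\<^sup>2 - 1)) ^ (n - 1)"

text \<open>With t = 1/n the logarithm of the ratio is -(n/2) ((1+t) ln(1+t) + (1-t) ln(1-t)), which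
  \<open>sq_less_entropy_sum\<close> puts strictly below -1/(2n).\<close>

lemma ellipsoid_volume_ratio:
  assumes "n \<ge> 2"
  shows "0 < ellipsoid_volume_ratio n" and "ellipsoid_volume_ratio n < exp (- 1 / (2 * real n))"
proof -
  define x where "x = real n"
  have x: "x \<ge> 2" using assms by (simp add: x_def)
  have x2: "x\<^sup>2 - 1 = (x - 1) * (x + 1)" by (simp add: algebra_simps power2_eq_square)
  have s: "0 < sqrt (x\<^sup>2 - 1)" using x by (simp add: x2)
  have n1: "real (n - 1) = x - 1" using assms by (simp add: x_def of_nat_diff)
  have e: "ellipsoid_volume_ratio n = x / (x + 1) * (x / sqrt (x\<^sup>2 - 1)) ^ (n - 1)"
    by (simp add: ellipsoid_volume_ratio_def x_def)
  show pos: "0 < ellipsoid_volume_ratio n"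
    unfolding e using x s by (intro mult_pos_pos zero_less_power divide_pos_pos) auto
  define S where "S = sqrt (x\<^sup>2 - 1)"
  have lnS: "ln S = (ln (x - 1) + ln (x + 1)) / 2"
    using x by (simp add: S_def x2 ln_sqrt ln_mult)
  have "ln (ellipsoid_volume_ratio n) = ln (x / (x + 1)) + (x - 1) * ln (x / S)"
    unfolding e S_def[symmetric] n1[symmetric] using x s
    by (subst ln_mult) (simp_all only: ln_realpow S_def[symmetric] zero_less_power divide_pos_pos, simp_all)
  also have "\<dots> = (ln x - ln (x + 1)) + (x - 1) * (ln x - (ln (x - 1) + ln (x + 1)) / 2)"
    using x s by (simp add: ln_div lnS S_def[symmetric])
  also have "\<dots> = x * ln x - (x + 1) / 2 * ln (x + 1) - (x - 1) / 2 * ln (x - 1)"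
    by (simp add: field_simps)
  \<comment> \<open>The coefficients of \<open>ln x\<close>, \<open>ln (x + 1)\<close>, \<open>ln (x - 1)\<close> add up to 0, which allows the substitution \<open>t = 1/x\<close>.\<close>
  also have "\<dots> = - x / 2 * ((1 + 1/x) * ln (1 + 1/x) + (1 - 1/x) * ln (1 - 1/x))"
  proof -
    have "1 + 1/x = (x + 1) / x" "1 - 1/x = (x - 1) / x" using x by (simp_all add: field_simps)
    then have l: "ln (1 + 1/x) = ln (x + 1) - ln x" "ln (1 - 1/x) = ln (x - 1) - ln x"
      using x by (simp_all add: ln_div)
    show ?thesis unfolding l using x by (simp add: divide_simps) (simp add: algebra_simps)
  qed
  also have "\<dots> < - x / 2 * (1/x)\<^sup>2"
    using sq_less_entropy_sum[of "1/x"] x by (intro mult_strict_left_mono_neg) auto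
  also have "\<dots> = - 1 / (2 * x)"
    using x by (simp add: power2_eq_square)
  finally have "exp (ln (ellipsoid_volume_ratio n)) < exp (- 1 / (2 * x))" by simp
  then show "ellipsoid_volume_ratio n < exp (- 1 / (2 * real n))"
    using pos by (simp add: x_def)
qed

section \<open>Determinants of contractions and balls inside ellipsoids\<close>

text \<open>Column j is the image of a unit vector, so all entries have absolute value at most 1,
  and each of the n! terms of the Leibniz expansion does too. What matters is only that the bound
  depends on the dimension alone.\<close>

lemma abs_det_le_fact:
  fixes M :: "real ^ 'n ^ 'n"
  assumes "\<And>x. norm (M *v x) \<le> norm x"
  shows "\<bar>det M\<bar> \<le> fact CARD('n)"
proof -
  have entry: "\<bar>M $ i $ j\<bar> \<le> 1" for i j
  proof -
    have "\<bar>M $ i $ j\<bar> = \<bar>(M *v axis j 1) $ i\<bar>"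
      by (simp add: matrix_vector_mult_basis column_def)
    also have "\<dots> \<le> norm (M *v axis j 1)" by (rule component_le_norm_cart)
    also have "\<dots> \<le> 1" using assms[of "axis j 1"] by simp
    finally show ?thesis .
  qed
  have "\<bar>det M\<bar> \<le> (\<Sum>p | p permutes (UNIV :: 'n set). \<bar>of_int (sign p) * (\<Prod>i\<in>UNIV. M $ i $ p i)\<bar>)"
    unfolding det_def by (rule sum_abs)
  also have "\<dots> \<le> (\<Sum>p | p permutes (UNIV :: 'n set). 1)"
    by (intro sum_mono) (auto simp: abs_mult abs_prod sign_def intro!: prod_le_1 entry)
  also have "\<dots> = fact CARD('n)"
    by (simp add: card_permutations)
  finally show ?thesis .
qed

text \<open>All powers of a contraction obey the crude bound above, so \<open>\<bar>det M\<bar> ^ k\<close> stays bounded.\<close>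

lemma abs_det_le_1_of_contraction:
  fixes M :: "real ^ 'n ^ 'n"
  assumes M: "\<And>x. norm (M *v x) \<le> norm x"
  shows "\<bar>det M\<bar> \<le> 1"
proof (rule ccontr)
  assume gt: "\<not> \<bar>det M\<bar> \<le> 1"
  have "\<exists>P :: real ^ 'n ^ 'n. (\<forall>x. norm (P *v x) \<le> norm x) \<and> det P = det M ^ k" for k
  proof (induction k)
    case 0
    show ?case by (rule exI[of _ "mat 1"]) simp
  next
    case (Suc k)
    then obtain P :: "real ^ 'n ^ 'n"
      where P: "\<And>x. norm (P *v x) \<le> norm x" "det P = det M ^ k" by blast
    have "norm ((M ** P) *v x) \<le> norm x" for x
      using M[of "P *v x"] P(1)[of x] by (simp add: matrix_vector_mul_assoc[symmetric])
    then show ?case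
      using P(2) by (intro exI[of _ "M ** P"]) (simp add: det_mul)
  qed
  then have "\<bar>det M\<bar> ^ k \<le> fact CARD('n)" for k
    using abs_det_le_fact by (metis power_abs)
  moreover obtain k where "fact CARD('n) < \<bar>det M\<bar> ^ k"
    using gt real_arch_pow[of "\<bar>det M\<bar>" "fact CARD('n)"] by auto
  ultimately show False by (meson not_le)
qed

lemma power_radius_le_abs_det:
  fixes A :: "real ^ 'n ^ 'n"
  assumes r: "0 < r" and sub: "cball p r \<subseteq> (\<lambda>y. c + A *v y) ` cball 0 1"
    and A: "invertible A"
  shows "r ^ CARD('n) \<le> \<bar>det A\<bar>"
proof -
  define M where "M = r *\<^sub>R matrix_inv A"
  have AM: "A ** M = r *\<^sub>R mat 1"
    by (simp add: M_def matrix_scalar_ac matrix_inv_right[OF A] scalar_matrix_assoc[symmetric])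
  have inj: "inj ((*v) A)" using A by (rule inj_matrix_vector_mult)
  have unit: "norm (M *v u) \<le> 1" if "norm u = 1" for u
  proof -
    \<comment> \<open>Subtracting the two antipodal points eliminates both centres \<open>p\<close>
      and \<open>c\<close>, which may differ. Half the difference of their preimages still has norm
      at most 1 and is \<open>M *v u\<close>.\<close>
    have "p + r *\<^sub>R u \<in> cball p r" "p - r *\<^sub>R u \<in> cball p r"
      using that r by (simp_all add: dist_norm)
    then have "p + r *\<^sub>R u \<in> (\<lambda>y. c + A *v y) ` cball 0 1" "p - r *\<^sub>R u \<in> (\<lambda>y. c + A *v y) ` cball 0 1"
      using sub by blast+
    then obtain y z where y: "p + r *\<^sub>R u = c + A *v y" "norm y \<le> 1"
      and z: "p - r *\<^sub>R u = c + A *v z" "norm z \<le> 1"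
      by (auto simp only: image_iff mem_cball_0)
    have "(2 * r) *\<^sub>R u = (p + r *\<^sub>R u) - (p - r *\<^sub>R u)"
      by (simp add: algebra_simps flip: scaleR_2)
    also have "\<dots> = A *v (y - z)"
      unfolding y z by (simp add: matrix_vector_mult_diff_distrib)
    finally have "(1/2) *\<^sub>R ((2 * r) *\<^sub>R u) = A *v ((1/2) *\<^sub>R (y - z))"
      by (simp only: matrix_vector_mult_scaleR)
    then have "r *\<^sub>R u = A *v ((1/2) *\<^sub>R (y - z))" by simp
    moreover have "A *v (M *v u) = r *\<^sub>R u"
      by (simp add: matrix_vector_mul_assoc AM scaleR_matrix_vector_assoc[symmetric])
    ultimately have "M *v u = (1/2) *\<^sub>R (y - z)"
      using inj by (simp add: inj_def)
    moreover have "norm (y - z) \<le> 2"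
      using norm_triangle_ineq4[of y z] y z by simp
    ultimately show ?thesis by simp
  qed
  have "norm (M *v x) \<le> norm x" for x
  proof (cases "x = 0")
    case False
    then have "norm (M *v ((1 / norm x) *\<^sub>R x)) \<le> 1" by (intro unit) simp
    then show ?thesis using False by (simp add: matrix_vector_mult_scaleR field_simps)
  qed simp
  then have "\<bar>det M\<bar> \<le> 1" by (rule abs_det_le_1_of_contraction)
  moreover have "det A * det M = r ^ CARD('n)"
    unfolding det_mul[symmetric] AM by (simp add: det_diagonal mat_def)
  then have "\<bar>det A\<bar> * \<bar>det M\<bar> = r ^ CARD('n)"
    using r by (simp flip: abs_mult)
  ultimately show ?thesis
    by (metis abs_ge_zero mult.right_neutral mult_left_mono)
qed

section \<open>One step of the method on a factor of the matrix\<close>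

text \<open>Pulling back along A reduces the step to the unit ball cut by a half-space with normal
  A^T w. A rotation U takes a coordinate axis to this normal. The half-ball then lies in the
  ellipsoid with centre -1/(n+1) on that axis, semi-axis \<open>a\<close> along it and
  \<open>b\<close> in all other directions; the new factor is A U D with D the diagonal matrix of
  the semi-axes.\<close>

lemma ellipsoid_step_factor:
  fixes A :: "real ^ 'n ^ 'n" and c w :: "real ^ 'n"
  assumes n: "CARD('n) \<ge> 2" and A: "invertible A" and w: "w \<noteq> 0"
  obtains A' c' where "ellipsoid_step w (c, A ** transpose A) = (c', A' ** transpose A')"
    and "invertible A'" and "\<bar>det A'\<bar> = ellipsoid_volume_ratio CARD('n) * \<bar>det A\<bar>"
    and "{x \<in> (\<lambda>y. c + A *v y) ` cball 0 1. w \<bullet> (x - c) \<le> 0} \<subseteq> (\<lambda>y. c' + A' *v y) ` cball 0 1"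
proof -
  define m where "m = real CARD('n)"
  define a where "a = m / (m + 1)"
  define b where "b = m / sqrt (m\<^sup>2 - 1)"
  have m: "m \<ge> 2" using n by (simp add: m_def)
  have m2: "m\<^sup>2 - 1 > 0" using power_mono[OF m, of 2] by simp
  have a: "a > 0" and b: "b > 0" using m m2 by (simp_all add: a_def b_def)
  have b2: "b\<^sup>2 = m\<^sup>2 / (m\<^sup>2 - 1)" using m2 by (simp add: b_def power_divide)
  \<comment> \<open>This relation turns D D^T into a multiple of the identity minus a rank-one term,
    with the coefficients of the update of H.\<close>
  have ab: "a\<^sup>2 = b\<^sup>2 * (1 - 2 / (m + 1))"
  proof -
    have "m\<^sup>2 - 1 = (m - 1) * (m + 1)" by (simp add: algebra_simps power2_eq_square)
    then show ?thesis using m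
      by (simp add: a_def b2 power_divide divide_simps) (simp add: algebra_simps power2_eq_square)
  qed
  \<comment> \<open>Any coordinate serves as the axis; \<open>undefined\<close> merely names
    one.\<close>
  define k :: 'n where "k = undefined"
  define v where "v = w v* A"
  have "v \<noteq> 0"
  proof
    assume "v = 0"
    then have "transpose A *v w = transpose A *v 0" by (simp add: v_def)
    then show False
      using w inj_matrix_vector_mult[OF transpose_invertible[OF A]] by (metis injD)
  qed
  define u where "u = (1 / norm v) *\<^sub>R v"
  have vu: "v = norm v *\<^sub>R u" and nu: "norm u = 1" using \<open>v \<noteq> 0\<close> by (simp_all add: u_def)
  obtain U where U: "orthogonal_matrix U" "U *v axis k 1 = u"
    using orthogonal_matrix_exists_basis[OF nu] by blast
  have UU: "U ** transpose U = mat 1" "transpose U ** U = mat 1"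
    using U(1) by (simp_all add: orthogonal_matrix_def)
  define D :: "real ^ 'n ^ 'n" where "D = (\<chi> i j. if i = j then if i = k then a else b else 0)"
  have D_mult: "(D *v y) $ i = (if i = k then a else b) * y $ i" for y i
    by (simp add: D_def matrix_vector_mult_def if_distrib[of "\<lambda>t. t * _"] cong: if_cong)
  have DD: "D ** transpose D = b\<^sup>2 *\<^sub>R (mat 1 - (2 / (m + 1)) *\<^sub>R outer_prod (axis k 1) (axis k 1))"
  proof -
    have "(D ** transpose D) $ i $ j = (if i = j then if i = k then a\<^sup>2 else b\<^sup>2 else 0)" for i j
      by (simp add: D_def matrix_matrix_mult_def transpose_def power2_eq_square
          if_distrib[of "\<lambda>t. t * _"] cong: if_cong)
    then show ?thesis
      by (simp add: vec_eq_iff mat_def outer_prod_def axis_def ab)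
  qed
  define A' where "A' = A ** U ** D"
  define c' where "c' = c - (1 / (m + 1)) *\<^sub>R (A *v u)"
  define H where "H = A ** transpose A"
  have "transpose A *v w = norm v *\<^sub>R u"
    unfolding vu[symmetric] by (simp add: v_def)
  then have Hw: "H *v w = norm v *\<^sub>R (A *v u)"
    unfolding H_def by (metis matrix_vector_mul_assoc matrix_vector_mult_scaleR)
  have "w v* H = transpose H *v w" by simp
  also have "\<dots> = H *v w" by (simp add: H_def matrix_transpose_mul)
  finally have wH: "w v* H = norm v *\<^sub>R (A *v u)" by (simp only: Hw)
  have q: "w \<bullet> (H *v w) = (norm v)\<^sup>2"
  proof -
    have "w \<bullet> (H *v w) = norm v * (v \<bullet> u)"
      by (simp add: Hw v_def dot_lmul_matrix)
    also have "v \<bullet> u = norm v"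
      using nu by (subst vu) (simp add: norm_eq_1)
    finally show ?thesis by (simp add: power2_eq_square)
  qed
  \<comment> \<open>The length of A^T w cancels: the update depends only on the direction
    \<open>u\<close>.\<close>
  have rank1: "(1 / (norm v)\<^sup>2) *\<^sub>R (H ** outer_prod w w ** H) = outer_prod (A *v u) (A *v u)"
    using \<open>v \<noteq> 0\<close>
    by (simp add: matrix_outer_prod outer_prod_matrix Hw wH outer_prod_scaleR power2_eq_square)
  have "A' ** transpose A' = (A ** U) ** (D ** transpose D) ** transpose (A ** U)"
    by (simp add: A'_def matrix_transpose_mul matrix_mul_assoc)
  also have "\<dots> = b\<^sup>2 *\<^sub>R ((A ** U) ** transpose (A ** U)
      - (2 / (m + 1)) *\<^sub>R (A ** U ** outer_prod (axis k 1) (axis k 1) ** transpose (A ** U)))"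
    by (simp add: DD matrix_scalar_ac scalar_matrix_assoc[symmetric] matrix_diff_ldistrib
        matrix_diff_rdistrib scaleR_diff_right)
  also have "(A ** U) ** transpose (A ** U) = H"
    using UU(1) by (metis H_def matrix_mul_assoc matrix_mul_rid matrix_transpose_mul)
  also have "A ** U ** outer_prod (axis k 1) (axis k 1) ** transpose (A ** U)
      = outer_prod (A *v u) (A *v u)"
    by (simp add: matrix_outer_prod outer_prod_matrix U(2)[symmetric] matrix_vector_mul_assoc
        flip: transpose_matrix_vector)
  finally have A'A': "A' ** transpose A' = b\<^sup>2 *\<^sub>R (H - (2 / (m + 1)) *\<^sub>R outer_prod (A *v u) (A *v u))" .
  show thesis
  proof (rule that)
    show "ellipsoid_step w (c, A ** transpose A) = (c', A' ** transpose A')"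
      unfolding ellipsoid_step_def Let_def fst_conv snd_conv H_def[symmetric] m_def[symmetric] q
        rank1 A'A' b2
      using \<open>v \<noteq> 0\<close> by (simp add: Hw c'_def)
    have detD: "det D = ellipsoid_volume_ratio CARD('n)"
    proof -
      have "det D = (\<Prod>i\<in>UNIV. if i = k then a else b)"
        by (subst det_diagonal) (simp_all add: D_def)
      also have "\<dots> = a * (\<Prod>i\<in>UNIV - {k}. if i = k then a else b)"
        by (subst prod.remove[of _ k]) simp_all
      also have "(\<Prod>i\<in>UNIV - {k}. if i = k then a else b) = b ^ (CARD('n) - 1)"
        by (subst prod.cong[OF refl, of _ _ "\<lambda>_. b"]) (simp_all add: card_Diff_subset)
      finally show ?thesis by (simp add: ellipsoid_volume_ratio_def a_def b_def m_def)
    qed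
    have detU: "\<bar>det U\<bar> = 1"
      using det_orthogonal_matrix[OF U(1)] by auto
    show "\<bar>det A'\<bar> = ellipsoid_volume_ratio CARD('n) * \<bar>det A\<bar>"
      using ellipsoid_volume_ratio(1)[OF n]
      by (simp add: A'_def det_mul abs_mult detD detU)
    then show "invertible A'"
      using A ellipsoid_volume_ratio(1)[OF n] by (auto simp: invertible_det_nz)
    show "{x \<in> (\<lambda>y. c + A *v y) ` cball 0 1. w \<bullet> (x - c) \<le> 0} \<subseteq> (\<lambda>y. c' + A' *v y) ` cball 0 1"
    proof
      fix x assume "x \<in> {x \<in> (\<lambda>y. c + A *v y) ` cball 0 1. w \<bullet> (x - c) \<le> 0}"
      then obtain y where x: "x = c + A *v y" and y: "norm y \<le> 1" and "w \<bullet> (A *v y) \<le> 0"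
        by auto
      then have "v \<bullet> y \<le> 0" by (simp add: v_def dot_lmul_matrix)
      then have uy: "u \<bullet> y \<le> 0"
        using \<open>v \<noteq> 0\<close> by (simp add: u_def divide_le_0_iff)
      define s where "s = transpose U *v y"
      have Us: "U *v s = y"
        unfolding s_def by (metis UU(1) matrix_vector_mul_assoc matrix_vector_mul_lid)
      have "s \<bullet> s = y \<bullet> (U *v s)"
        unfolding s_def by (simp add: dot_lmul_matrix)
      then have ns: "norm s \<le> 1"
        using y by (simp add: Us norm_eq_sqrt_inner)
      have "s \<bullet> axis k 1 = y \<bullet> u"
        unfolding s_def U(2)[symmetric] by (simp add: dot_lmul_matrix)
      then have sk: "s $ k \<le> 0"
        using uy by (simp add: inner_axis inner_commute)
      have "\<bar>s $ k\<bar> \<le> 1" using component_le_norm_cart[of s k] ns by linarith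
      then have sk1: "- 1 \<le> s $ k" by linarith
      \<comment> \<open>Solves D t = s + e_k / (m+1), so \<open>t\<close> holds the coordinates of
        \<open>x\<close> relative to the new centre and factor. It remains to bound its norm by
        1.\<close>
      define t where "t = (\<chi> i. if i = k then (s $ k + 1 / (m + 1)) / a else s $ i / b)"
      have Dt: "D *v t = s + (1 / (m + 1)) *\<^sub>R axis k 1"
        using a b by (simp add: vec_eq_iff D_mult t_def axis_def)
      have "A' *v t = A *v (U *v (D *v t))"
        by (simp add: A'_def matrix_vector_mul_assoc matrix_mul_assoc)
      also have "\<dots> = A *v y + (1 / (m + 1)) *\<^sub>R (A *v u)"
        by (simp add: Dt matrix_vector_right_distrib matrix_vector_mult_scaleR Us U(2))
      finally have xt: "x = c' + A' *v t" by (simp add: x c'_def)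
      have split: "(norm z)\<^sup>2 = (z $ k)\<^sup>2 + (\<Sum>i\<in>UNIV - {k}. (z $ i)\<^sup>2)" for z :: "real ^ 'n"
        unfolding norm_vec_def L2_set_def
        by (simp add: sum_nonneg) (rule sum.remove, simp_all)
      have "(norm t)\<^sup>2 = ((s $ k + 1 / (m + 1)) / a)\<^sup>2 + (\<Sum>i\<in>UNIV - {k}. (s $ i)\<^sup>2) / b\<^sup>2"
        unfolding split by (simp add: t_def power_divide sum_divide_distrib)
      also have "\<dots> = ((s $ k + 1 / (m + 1)) / a)\<^sup>2 + ((norm s)\<^sup>2 - (s $ k)\<^sup>2) / b\<^sup>2"
        using split[of s] by simp
      also have "\<dots> \<le> ((s $ k + 1 / (m + 1)) / a)\<^sup>2 + (1 - (s $ k)\<^sup>2) / b\<^sup>2"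
        using ns by (intro add_left_mono divide_right_mono diff_right_mono)
          (simp_all add: power_le_one)
      \<comment> \<open>The deviation from 1 is a positive multiple of s_k (s_k + 1), which is
        nonpositive because the half-ball has -1 \<le> s_k \<le> 0.\<close>
      also have "\<dots> = 1 + 2 * (m + 1) / m\<^sup>2 * (s $ k * (s $ k + 1))"
      proof -
        have 1: "(s $ k + 1 / (m + 1)) / a = ((m + 1) * s $ k + 1) / m"
          using m by (simp add: a_def divide_simps)
        show ?thesis
          unfolding 1 b2 using m
          by (simp add: power_divide divide_simps)
             (simp add: algebra_simps power2_eq_square divide_eq_eq)
      qed
      also have "\<dots> \<le> 1"
        using m mult_nonneg_nonpos[of "2 * (m + 1) / m\<^sup>2" "s $ k * (s $ k + 1)"]
          mult_nonpos_nonneg[OF sk, of "s $ k + 1"] sk1 by simp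
      finally have "norm t \<le> 1" by (simp add: abs_square_le_1)
      then show "x \<in> (\<lambda>y. c' + A' *v y) ` cball 0 1"
        using xt by auto
    qed
  qed
qed

section \<open>The invariant along the iteration\<close>

text \<open>A predicate rather than a function, since A is determined by A A^T only up to an
  orthogonal factor on the right; for the same reason only the absolute value of the determinant is
  tracked. The set is recorded separately because index 0 is defined as a ball and not through the
  matrix.\<close>

definition ellipsoid_factor ::
  "real ^ 'n \<Rightarrow> real \<Rightarrow> (nat \<Rightarrow> real ^ 'n) \<Rightarrow> nat \<Rightarrow> real ^ 'n ^ 'n \<Rightarrow> bool" where
  "ellipsoid_factor c R w k A \<longleftrightarrow>
     invertible A \<and> ell_matrix c R w k = A ** transpose A \<and>
     \<bar>det A\<bar> = R ^ CARD('n) * ellipsoid_volume_ratio CARD('n) ^ k \<and>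
     ell_set c R w k = (\<lambda>y. ell_center c R w k + A *v y) ` cball 0 1"

lemma ellipsoid_factor_0:
  fixes c :: "real ^ 'n"
  assumes "R > 0"
  shows "ellipsoid_factor c R w 0 (R *\<^sub>R mat 1)"
proof -
  have det: "det (R *\<^sub>R mat 1 :: real ^ 'n ^ 'n) = R ^ CARD('n)"
    by (simp add: det_diagonal mat_def)
  have "(\<lambda>y. c + (R *\<^sub>R mat 1) *v y) = (\<lambda>y. R *\<^sub>R y + c)"
    by (simp add: fun_eq_iff add.commute flip: scaleR_matrix_vector_assoc)
  moreover have "(\<lambda>y. R *\<^sub>R y + c) ` cball 0 1 = cball c R"
  proof -
    have "(\<lambda>y. R *\<^sub>R y + c) ` cball 0 1 = (+) c ` (*\<^sub>R) R ` cball 0 1"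
      by (simp only: image_image add.commute)
    also have "(*\<^sub>R) R ` cball 0 1 = (cball 0 R :: (real ^ 'n) set)"
      using assms cball_scale[of R 0 1] by simp
    also have "(+) c ` cball 0 R = cball (c + 0) R"
      by (rule cball_translation[symmetric])
    finally show ?thesis by simp
  qed
  ultimately have "cball c R = (\<lambda>y. c + (R *\<^sub>R mat 1) *v y) ` cball 0 1"
    by (simp only:)
  then show ?thesis
    using assms det
    by (simp add: ellipsoid_factor_def ell_matrix_def ell_center_def invertible_det_nz
        transpose_scalar matrix_scalar_ac power2_eq_square flip: scalar_matrix_assoc)
qed

lemma ellipsoid_factor_Suc:
  fixes c :: "real ^ 'n"
  assumes n: "CARD('n) \<ge> 2" and w: "w k \<noteq> 0" and A: "ellipsoid_factor c R w k A"
  obtains A' where "ellipsoid_factor c R w (Suc k) A'"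
    and "{x \<in> ell_set c R w k. w k \<bullet> (x - ell_center c R w k) \<le> 0} \<subseteq> ell_set c R w (Suc k)"
proof -
  let ?c = "ell_center c R w"
  have inv: "invertible A" using A by (simp add: ellipsoid_factor_def)
  obtain A' c' where step: "ellipsoid_step (w k) (?c k, A ** transpose A) = (c', A' ** transpose A')"
    and A': "invertible A'" "\<bar>det A'\<bar> = ellipsoid_volume_ratio CARD('n) * \<bar>det A\<bar>"
    and sub: "{x \<in> (\<lambda>y. ?c k + A *v y) ` cball 0 1. w k \<bullet> (x - ?c k) \<le> 0}
      \<subseteq> (\<lambda>y. c' + A' *v y) ` cball 0 1"
    by (rule ellipsoid_step_factor[where c = "?c k", OF n inv w])
  have "ellipsoid_state c R w k = (?c k, A ** transpose A)"
    using A by (simp add: ellipsoid_factor_def ell_center_def ell_matrix_def prod_eq_iff)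
  then have c': "?c (Suc k) = c'" and H': "ell_matrix c R w (Suc k) = A' ** transpose A'"
    using step by (simp_all add: ell_center_def ell_matrix_def)
  have set: "ell_set c R w (Suc k) = (\<lambda>y. c' + A' *v y) ` cball 0 1"
    unfolding ell_set.simps c' H' by (rule ellipsoid_eq_linear_image[OF A'(1)])
  show thesis
  proof (rule that)
    show "ellipsoid_factor c R w (Suc k) A'"
      using A A' by (simp add: ellipsoid_factor_def c' H' set del: ell_set.simps)
    show "{x \<in> ell_set c R w k. w k \<bullet> (x - ?c k) \<le> 0} \<subseteq> ell_set c R w (Suc k)"
      using A sub unfolding set by (simp add: ellipsoid_factor_def)
  qed
qed

lemma ellipsoid_factor_exists:
  fixes c :: "real ^ 'n"
  assumes "CARD('n) \<ge> 2" and "R > 0" and "\<And>j. j < k \<Longrightarrow> w j \<noteq> 0"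
  shows "\<exists>A. ellipsoid_factor c R w k A"
  using assms(3)
proof (induction k)
  case 0
  show ?case using ellipsoid_factor_0[OF assms(2)] by blast
next
  case (Suc k)
  then obtain A where "ellipsoid_factor c R w k A" by auto
  then show ?case
    using ellipsoid_factor_Suc[where w = w and k = k, OF assms(1) Suc.prems[OF lessI]] by blast
qed

section \<open>Points lost during the iteration\<close>

lemma cut_off_point:
  fixes c :: "real ^ 'n"
  assumes n: "CARD('n) \<ge> 2" and R: "R > 0" and w: "\<And>j. j < N \<Longrightarrow> w j \<noteq> 0"
    and x: "x \<in> cball c R" "x \<notin> ell_set c R w N"
  obtains k where "k < N" and "x \<in> ell_set c R w k" and "w k \<bullet> (x - ell_center c R w k) > 0"
proof -
  \<comment> \<open>The first index whose ellipsoid misses \<open>x\<close> is not 0, so it has the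
    form \<open>Suc k\<close>, and \<open>x\<close> is lost exactly in step
    \<open>k\<close>.\<close>
  obtain k where k: "k < N" "x \<in> ell_set c R w k" "x \<notin> ell_set c R w (Suc k)"
    using x ex_least_nat_less[of "\<lambda>k. x \<notin> ell_set c R w k" N] by auto
  obtain A where "ellipsoid_factor c R w k A"
    using ellipsoid_factor_exists[OF n R, of k w] w k(1) by (meson less_trans)
  then have "{x \<in> ell_set c R w k. w k \<bullet> (x - ell_center c R w k) \<le> 0} \<subseteq> ell_set c R w (Suc k)"
    by (rule ellipsoid_factor_Suc[where w = w and k = k, OF n w[OF k(1)]])
  with k(2,3) have "\<not> w k \<bullet> (x - ell_center c R w k) \<le> 0" by blast
  then show thesis by (intro that[OF k(1,2)]) simp
qed

text \<open>The value of \<theta> makes (\<theta> \<rho>)^n equal to R^n exp(-N/(2n)). Since N > 0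
  and the bound on the volume ratio is strict, the determinant for step N is strictly smaller, which
  excludes even a ball of radius exactly \<theta> \<rho>.\<close>

lemma small_copy_escapes_ellipsoid:
  fixes c :: "real ^ 'n"
  assumes n: "CARD('n) \<ge> 2" and R: "R > 0" and N: "N > 0" and w: "\<And>j. j < N \<Longrightarrow> w j \<noteq> 0"
    and \<rho>: "\<rho> > 0" and z: "cball z \<rho> \<subseteq> Q"
    and \<theta>: "\<theta> = R / \<rho> * exp (- real N / (2 * (real CARD('n))\<^sup>2))"
  obtains y where "y \<in> Q" and "(1 - \<theta>) *\<^sub>R x0 + \<theta> *\<^sub>R y \<notin> ell_set c R w N"
proof -
  have "\<theta> > 0" unfolding \<theta> using R \<rho> by simp
  obtain A where A: "ellipsoid_factor c R w N A"
    using ellipsoid_factor_exists[OF n R, of N w] w by blast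
  have "\<bar>det A\<bar> = R ^ CARD('n) * ellipsoid_volume_ratio CARD('n) ^ N"
    using A by (simp add: ellipsoid_factor_def)
  also have "\<dots> < R ^ CARD('n) * exp (- 1 / (2 * real CARD('n))) ^ N"
    using R N ellipsoid_volume_ratio[OF n] by (intro mult_strict_left_mono power_strict_mono) auto
  also have "exp (- 1 / (2 * real CARD('n))) ^ N = exp (- real N / (2 * (real CARD('n))\<^sup>2)) ^ CARD('n)"
    by (simp add: power2_eq_square flip: exp_of_nat_mult)
  also have "R ^ CARD('n) * \<dots> = (\<theta> * \<rho>) ^ CARD('n)"
    using \<rho> by (simp add: \<theta> power_mult_distrib)
  finally have "\<not> cball ((1 - \<theta>) *\<^sub>R x0 + \<theta> *\<^sub>R z) (\<theta> * \<rho>) \<subseteq> ell_set c R w N"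
    using A power_radius_le_abs_det[of "\<theta> * \<rho>" _ _ A] \<open>\<theta> > 0\<close> \<rho>
    unfolding ellipsoid_factor_def by (metis mult_pos_pos not_le)
  then obtain x where x: "dist ((1 - \<theta>) *\<^sub>R x0 + \<theta> *\<^sub>R z) x \<le> \<theta> * \<rho>" "x \<notin> ell_set c R w N"
    by (meson mem_cball subsetI)
  \<comment> \<open>The preimage of \<open>x\<close> under the homothety that maps y to (1 -
    \<theta>) x0 + \<theta> y.\<close>
  define y where "y = z + (1 / \<theta>) *\<^sub>R (x - ((1 - \<theta>) *\<^sub>R x0 + \<theta> *\<^sub>R z))"
  have "dist z y \<le> \<rho>"
    using x(1) \<open>\<theta> > 0\<close> by (simp add: y_def dist_norm norm_minus_commute divide_le_eq mult.commute)
  moreover have "(1 - \<theta>) *\<^sub>R x0 + \<theta> *\<^sub>R y = x"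
    using \<open>\<theta> > 0\<close> by (simp add: y_def algebra_simps)
  ultimately show thesis using that[of y] x(2) z by auto
qed

section \<open>Existence and accuracy of the output\<close>

theorem mainTheorem2:
  fixes Q :: "(real ^ 'n) set" and g :: "real ^ 'n \<Rightarrow> real"
    and c z :: "real ^ 'n" and R \<rho> B \<delta> :: real and N :: nat
    and w :: "nat \<Rightarrow> real ^ 'n"
  assumes "CARD('n) \<ge> 2"
    and "convex Q" and "compact Q"
    and "Q \<subseteq> cball c R"
    and "\<rho> > 0" and "cball z \<rho> \<subseteq> Q"
    and "continuous_on Q g" and "convex_on Q g"
    and "B > 0" and "\<And>x x'. x \<in> Q \<Longrightarrow> x' \<in> Q \<Longrightarrow> \<bar>g x - g x'\<bar> \<le> B"
    and "\<delta> \<ge> 0"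
    and "N > 0" and "real N \<ge> 2 * (real CARD('n))\<^sup>2 * ln (R / \<rho>)"
    and "ellipsoid_execution Q g \<delta> c R N w"
  shows "ellipsoid_outputs Q g c R N w \<noteq> {} \<and>
    (\<forall>xN \<in> ellipsoid_outputs Q g c R N w. xN \<in> Q \<and>
      g xN - (LEAST m. m \<in> g ` Q)
        \<le> B * R / \<rho> * exp (- real N / (2 * (real CARD('n))\<^sup>2)) + \<delta>)"
proof -
  let ?c = "ell_center c R w"
  define \<theta> where "\<theta> = R / \<rho> * exp (- real N / (2 * (real CARD('n))\<^sup>2))"
  have "z \<in> Q" using assms(5,6) by auto
  then obtain x0 where x0: "x0 \<in> Q" "\<And>y. y \<in> Q \<Longrightarrow> g x0 \<le> g y"
    using continuous_attains_inf[OF assms(3) _ assms(7)] by blast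
  have least: "(LEAST m. m \<in> g ` Q) = g x0"
    using x0 by (intro Least_equality) auto
  have "\<rho> \<le> R"
    using assms(4,5,6) cball_subset_cball_iff[of z \<rho> c R] by (smt (verit) dual_order.trans zero_le_dist)
  then have R: "R > 0" using assms(5) by simp
  have \<theta>0: "\<theta> > 0" using R assms(5) by (simp add: \<theta>_def)
  \<comment> \<open>The lower bound on N enters here: it makes the shrunken copy of Q towards
    \<open>x0\<close> consist of convex combinations, hence stay inside Q.\<close>
  have \<theta>1: "\<theta> \<le> 1"
  proof -
    have "ln (R / \<rho>) \<le> real N / (2 * (real CARD('n))\<^sup>2)"
      using assms(13) by (simp add: le_divide_eq mult.commute)
    then have "exp (ln (R / \<rho>)) * exp (- real N / (2 * (real CARD('n))\<^sup>2)) \<le> 1"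
      by (simp flip: exp_add)
    then show ?thesis using R assms(5) by (simp add: \<theta>_def)
  qed
  have adm: "admissible_choice Q g \<delta> c R w k"
    if "k < N" "\<And>j. j < k \<Longrightarrow> \<not> stops_at Q c R w j" for k
    using assms(14) that by (simp add: ellipsoid_execution_def)
  have "ellipsoid_outputs Q g c R N w \<noteq> {} \<and>
    (\<forall>xN \<in> ellipsoid_outputs Q g c R N w. xN \<in> Q \<and> g xN - g x0 \<le> B * \<theta> + \<delta>)"
  proof (cases "\<exists>k<N. stops_at Q c R w k")
    case True
    define k where "k = (LEAST k. stops_at Q c R w k)"
    \<comment> \<open>Minimality of \<open>k\<close> matters because admissibility is assumed only
      up to the first stop. There 0 is a \<delta>-subgradient, so the centre is optimal up to
      \<delta>.\<close>
    have stop: "stops_at Q c R w k" and first: "\<And>j. j < k \<Longrightarrow> \<not> stops_at Q c R w j" and "k < N"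
      using True unfolding k_def by (auto intro: LeastI dest: not_less_Least Least_le le_less_trans)
    have "?c k \<in> Q" "w k = 0" using stop by (simp_all add: stops_at_def)
    with adm[OF \<open>k < N\<close> first] x0(1) have "g x0 \<ge> g (?c k) - \<delta>"
      by (auto simp: admissible_choice_def delta_subdifferential_def)
    moreover have "B * \<theta> \<ge> 0" using assms(9) \<theta>0 by simp
    ultimately show ?thesis
      using True \<open>?c k \<in> Q\<close> by (simp add: ellipsoid_outputs_def flip: k_def)
  next
    case False
    then have adm': "admissible_choice Q g \<delta> c R w k" if "k < N" for k
      using that by (intro adm) auto
    have w: "w k \<noteq> 0" if "k < N" for k
      using adm'[OF that] False that by (auto simp: admissible_choice_def stops_at_def split: if_splits)
    obtain y where y: "y \<in> Q" "(1 - \<theta>) *\<^sub>R x0 + \<theta> *\<^sub>R y \<notin> ell_set c R w N"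
      using small_copy_escapes_ellipsoid[where w = w and N = N, OF assms(1) R assms(12) w assms(5,6) \<theta>_def] by metis
    define x where "x = (1 - \<theta>) *\<^sub>R x0 + \<theta> *\<^sub>R y"
    have "x \<in> Q"
      unfolding x_def using x0(1) y(1) \<theta>0 \<theta>1 by (intro convexD[OF assms(2)]) auto
    have "g x \<le> (1 - \<theta>) * g x0 + \<theta> * g y"
      unfolding x_def using x0(1) y(1) \<theta>0 \<theta>1 by (intro convex_onD[OF assms(8)]) auto
    also have "\<dots> = g x0 + \<theta> * (g y - g x0)" by (simp add: algebra_simps)
    also have "\<dots> \<le> g x0 + \<theta> * B"
      using assms(10)[OF y(1) x0(1)] \<theta>0 by (intro add_left_mono mult_left_mono) auto
    finally have gx: "g x \<le> g x0 + \<theta> * B" .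
    obtain k where k: "k < N" "x \<in> ell_set c R w k" "w k \<bullet> (x - ?c k) > 0"
      using cut_off_point[where w = w and N = N, OF assms(1) R w] \<open>x \<in> Q\<close> assms(4) y(2) unfolding x_def by (metis subsetD)
    \<comment> \<open>For a centre outside Q the half-space would have to contain \<open>x\<close>,
      a point of Q in the current ellipsoid, against the strict inequality for
      \<open>x\<close>.\<close>
    have ck: "?c k \<in> Q"
      using adm'[OF k(1)] k(2,3) \<open>x \<in> Q\<close> by (force simp: admissible_choice_def split: if_splits)
    have "g x \<ge> g (?c k) + w k \<bullet> (x - ?c k) - \<delta>"
      using adm'[OF k(1)] ck \<open>x \<in> Q\<close> by (simp add: admissible_choice_def delta_subdifferential_def)
    then have gk: "g (?c k) \<le> g x0 + \<theta> * B + \<delta>" using gx k(3) by simp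
    define S where "S = ?c ` {0..N} \<inter> Q"
    \<comment> \<open>The good centre \<open>?c k\<close> is among the candidates, so a minimizer
      exists and every minimizer is at least as good.\<close>
    have S: "finite S" "?c k \<in> S" using k(1) ck by (auto simp: S_def)
    have out: "ellipsoid_outputs Q g c R N w = {x. is_arg_min g (\<lambda>y. y \<in> S) x}"
      unfolding ellipsoid_outputs_def S_def if_not_P[OF False] by (rule refl)
    have "\<exists>x. is_arg_min g (\<lambda>y. y \<in> S) x"
      using ex_is_arg_min_if_finite[OF S(1)] S(2) by blast
    moreover have "x \<in> Q \<and> g x - g x0 \<le> B * \<theta> + \<delta>" if "is_arg_min g (\<lambda>y. y \<in> S) x" for x
    proof -
      have "x \<in> S" "g x \<le> g (?c k)" using that S(2) by (auto simp: is_arg_min_linorder)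
      then show ?thesis using gk by (auto simp: S_def mult.commute)
    qed
    ultimately show ?thesis unfolding out by blast
  qed
  moreover have bound: "B * R / \<rho> * exp (- real N / (2 * (real CARD('n))\<^sup>2)) = B * \<theta>"
    by (simp add: \<theta>_def)
  ultimately show ?thesis
    unfolding least bound by blast
qed

end
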